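(* Let $n,m$ be positive integers and $I\ge 0$ an integer, and consider the system $\dot x=\Pi(x)u$ on $\mathbb{S}^n$ with conic constraint zones $\mathcal{O}_i$, $i\in\mathbb{I}=\{0,\dots,I\}$, free space $\mathcal{M}$ and target $x_d$, satisfying assumptions (A1)–(A4) stated in the context. Let $\psi$ be the stereographic projection, $\tilde{\mathcal{M}}=\psi(\mathcal{M})$, $\Sigma(x)=\nabla\psi(x)\Pi(x)$ and $\Sigma(x)^+=\Sigma(x)^\top(\Sigma(x)\Sigma(x)^\top)^{-1}$, and put $\xi_d=\psi(x_d)$. If $v=\tilde\kappa(\xi,\xi_d)$ is a control law that solves Problem B with region of attraction $\tilde{\mathcal{R}}(\xi_d)\subseteq\tilde{\mathcal{M}}$, then $$u=\Sigma(x)^+\,\tilde\kappa(\psi(x),\psi(x_d))$$ is a control law that solves Problem A with region of attraction $\mathcal{R}(x_d)=\psi^{-1}\big(\tilde{\mathcal{R}}(\psi(x_d))\big)$ (asymptotic stability in Problem B yielding asymptotic stability in Problem A, and exponential stability in Problem B yielding exponential stability in Problem A). Moreover, if $\tilde\kappa(\cdot,\xi_d)$ is bounded on $\tilde{\mathcal{M}}$, then the control law $u$ is bounded on $\mathcal{M}$.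
   Context: $\mathbb{S}^n=\{x\in\mathbb{R}^{n+1}:\|x\|=1\}$, with tangent space $\mathsf{T}_x\mathbb{S}^n=\{z\in\mathbb{R}^{n+1}:z^\top x=0\}$ and geodesic distance $\mathbf{d}(x,y)=\arccos(x^\top y)$. $e_{n+1}$ is the last standard basis vector of $\mathbb{R}^{n+1}$ and $J_n=[\,I_n\;\;0_{n\times1}]\in\mathbb{R}^{n\times(n+1)}$. System: $\dot x=\Pi(x)u$, with $x\in\mathbb{S}^n$, $u\in\mathbb{R}^m$, where $\Pi:\mathbb{R}^{n+1}\to\mathbb{R}^{(n+1)\times m}$ is smooth and $\mathrm{Im}(\Pi(x))\subseteq\mathsf{T}_x\mathbb{S}^n$ for $x\in\mathbb{S}^n$. Constraints: $\mathcal{O}_i=\{x\in\mathbb{S}^n:x^\top a_i>\cos\theta_i\}$ with $a_i\in\mathbb{S}^n$, $\theta_i\in(0,\pi/2)$, $i\in\mathbb{I}=\{0,\dots,I\}$; the free space is $\mathcal{M}=\mathbb{S}^n\setminus\bigcup_{i\in\mathbb{I}}\mathcal{O}_i$. Assumptions: (A1) $\mathrm{rank}(\Pi(x))=n$ for all $x\in\mathbb{S}^n\setminus\{e_{n+1}\}$. (A2) $a_i^\top a_{i'}<\cos(\theta_i+\theta_{i'})$ for all $i\ne i'$ in $\mathbb{I}$. (A3) $a_0=e_{n+1}$. (A4) $x(0)\in\mathcal{M}$ and $x_d\in\mathbf{int}(\mathcal{M})$ (interior in $\mathbb{S}^n$). Stereographic projection: $\psi:\mathbb{S}^n\setminus\{e_{n+1}\}\to\mathbb{R}^n$,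 $\psi(x)=\dfrac{J_nx}{1-e_{n+1}^\top x}$, a diffeomorphism. Its Jacobian matrix is $\nabla\psi(x)=\dfrac{J_n\big((1-e_{n+1}^\top x)I_{n+1}+xe_{n+1}^\top\big)}{(1-e_{n+1}^\top x)^2}\in\mathbb{R}^{n\times(n+1)}$. Under (A1), $\Sigma(x)=\nabla\psi(x)\Pi(x)\in\mathbb{R}^{n\times m}$ has full row rank for every $x\in\mathbb{S}^n\setminus\{e_{n+1}\}$, so $\Sigma(x)^+$ is well defined there. Problem A (on $\mathbb{S}^n$): for $\dot x=\Pi(x)u$, design a control law $u=\kappa(x,x_d)$ that renders $\mathcal{M}$ forward invariant and $x=x_d$ an asymptotically (or exponentially) stable equilibrium with region of attraction $\mathcal{R}(x_d)\subseteq\mathcal{M}$. Problem B (on $\mathbb{R}^n$): for $\dot\xi=v$, $v\in\mathbb{R}^n$, and given $\xi_d\in\mathbf{int}(\tilde{\mathcal{M}})$, design a control law $v=\tilde\kappa(\xi,\xi_d)$ that renders $\tilde{\mathcal{M}}$ forward invariant and $\xi=\xi_d$ an asymptotically (or exponentially) stable equilibrium with region of attraction $\tilde{\mathcal{R}}(\xi_d)\subseteq\tilde{\mathcal{M}}$. Conventions: forward invariance of a set means every solution of the closed loop starting in the set stays in it for all $t\ge0$. Stability notions are with respect to $\mathbf{d}$ on $\mathcal{M}$ and the Euclidean distance on $\tilde{\mathcal{M}}$. The region of attraction is the set of all initial conditions in the free space ($\mathcal{M}$, respectively $\tilde{\mathcal{M}}$) from which solutions converge to the target as $t\to\infty$.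 *)

theory Defs
  imports "HOL-Analysis.Analysis"
begin

text \<open>
  For a finite index type \<open>'n\<close> with \<open>n\<close> elements, \<open>real ^ 'n\<close> is \<open>n\<close>-space and
  \<open>real ^ ('n option)\<close> is \<open>(n+1)\<close>-space: \<open>Some i\<close> indexes the first \<open>n\<close> coordinates and
  \<open>None\<close> the last one.  The unit sphere is \<open>sphere 0 1\<close>, and a matrix with \<open>p\<close> rows and \<open>q\<close>
  columns has type \<open>real ^ 'q ^ 'p\<close>.
\<close>

definition north :: "real ^ ('n::finite option)" where
  "north = axis None 1"

definition J_mat :: "real ^ ('n::finite option) ^ 'n" where
  "J_mat = (\<chi> i j. if j = Some i then 1 else 0)"

definition tangent_space :: "real ^ ('n::finite option) \<Rightarrow> (real ^ ('n option)) set" where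
  "tangent_space x = {z. z \<bullet> x = 0}"

definition geodesic_dist :: "real ^ ('n::finite option) \<Rightarrow> real ^ ('n option) \<Rightarrow> real" where
  "geodesic_dist x y = arccos (x \<bullet> y)"

text \<open>
  Smoothness on the whole space.  On a finite-dimensional domain, a differentiable map all of
  whose directional derivatives are \<open>k\<close> times continuously differentiable is \<open>k + 1\<close> times
  continuously differentiable, so derivatives are taken one direction at a time.
\<close>

primrec times_cont_differentiable ::
    "nat \<Rightarrow> ('a::euclidean_space \<Rightarrow> 'b::real_normed_vector) \<Rightarrow> bool" where
  "times_cont_differentiable 0 f \<longleftrightarrow> continuous_on UNIV f"
| "times_cont_differentiable (Suc k) f \<longleftrightarrow> (\<forall>x. f differentiable (at x)) \<and>
     (\<forall>v. times_cont_differentiable k (\<lambda>x. frechet_derivative f (at x) v))"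

definition smooth :: "('a::euclidean_space \<Rightarrow> 'b::real_normed_vector) \<Rightarrow> bool" where
  "smooth f \<longleftrightarrow> (\<forall>k. times_cont_differentiable k f)"

definition constraint_zone ::
    "real ^ ('n::finite option) \<Rightarrow> real \<Rightarrow> (real ^ ('n option)) set" where
  "constraint_zone a \<theta> = {x \<in> sphere 0 1. x \<bullet> a > cos \<theta>}"

definition free_space ::
    "nat \<Rightarrow> (nat \<Rightarrow> real ^ ('n::finite option)) \<Rightarrow> (nat \<Rightarrow> real) \<Rightarrow> (real ^ ('n option)) set" where
  "free_space N a \<theta> = sphere 0 1 - (\<Union>i\<in>{0..N}. constraint_zone (a i) (\<theta> i))"

text \<open>
  The stereographic projection and its Jacobian matrix; both are meaningful only where
  \<open>north \<bullet> x \<noteq> 1\<close>, that is, on the sphere, away from \<open>north\<close>.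
\<close>

definition stereo :: "real ^ ('n::finite option) \<Rightarrow> real ^ 'n" where
  "stereo x = (1 / (1 - north \<bullet> x)) *\<^sub>R (J_mat *v x)"

definition stereo_jacobian :: "real ^ ('n::finite option) \<Rightarrow> real ^ ('n option) ^ 'n" where
  "stereo_jacobian x = (1 / (1 - north \<bullet> x)\<^sup>2) *\<^sub>R
     (J_mat ** ((1 - north \<bullet> x) *\<^sub>R mat 1
        + (columnvector x :: real ^ 1 ^ ('n option)) ** rowvector north))"

lemma stereo_has_derivative:
  fixes x :: "real ^ ('n::finite option)"
  assumes "north \<bullet> x \<noteq> 1"
  shows "(stereo has_derivative (\<lambda>h. stereo_jacobian x *v h)) (at x)"
proof -
  have nz: "1 - north \<bullet> x \<noteq> 0"
    using assms by simp
  have lin: "((\<lambda>y. A *v y) has_derivative (\<lambda>h. A *v h)) (at x)"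
    for A :: "real ^ ('n option) ^ 'n"
    by (intro bounded_linear_imp_has_derivative matrix_vector_mul_bounded_linear)
  have rank_one: "((columnvector x :: real ^ 1 ^ ('n option)) ** rowvector north) *v h =
      (north \<bullet> h) *\<^sub>R x"
    for h :: "real ^ ('n option)"
    by (simp add: vec_eq_iff matrix_vector_mult_def matrix_matrix_mult_def columnvector_def
        rowvector_def inner_vec_def sum_distrib_left mult_ac)
  have jac: "stereo_jacobian x *v h =
      (1 / (1 - north \<bullet> x)) *\<^sub>R (J_mat *v h)
        + ((north \<bullet> h) / (1 - north \<bullet> x)\<^sup>2) *\<^sub>R (J_mat *v x)" for h
    using nz
    by (simp add: stereo_jacobian_def scaleR_matrix_vector_assoc[symmetric]
        matrix_vector_mul_assoc[symmetric] matrix_vector_mult_add_rdistrib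
        rank_one[folded matrix_vector_mul_assoc]
        matrix_vector_right_distrib matrix_vector_mult_scaleR scaleR_add_right power2_eq_square)
  show ?thesis
    unfolding stereo_def[abs_def] jac
    by (rule has_derivative_eq_rhs, (rule derivative_intros lin nz)+)
      (use nz in \<open>simp add: fun_eq_iff power2_eq_square divide_simps\<close>)
qed

definition Sigma_mat ::
    "(real ^ ('n::finite option) \<Rightarrow> real ^ 'm::finite ^ ('n option))
      \<Rightarrow> real ^ ('n option) \<Rightarrow> real ^ 'm ^ 'n" where
  "Sigma_mat P x = stereo_jacobian x ** P x"

definition right_pinv :: "real ^ 'm::finite ^ 'n::finite \<Rightarrow> real ^ 'n ^ 'm" where
  "right_pinv A = transpose A ** matrix_inv (A ** transpose A)"

text \<open>
  Solutions of \<open>x' = f x\<close> in the state space \<open>X\<close> on the time interval \<open>[0,T)\<close>, with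
  \<open>0 < T \<le> \<infinity>\<close>.  The derivative at time \<open>0\<close> is one-sided; values of \<open>x\<close> outside \<open>[0,T)\<close>
  are irrelevant.
\<close>

definition solution ::
    "('a::real_normed_vector \<Rightarrow> 'a) \<Rightarrow> 'a set \<Rightarrow> ereal \<Rightarrow> (real \<Rightarrow> 'a) \<Rightarrow> bool" where
  "solution f X T x \<longleftrightarrow> 0 < T \<and>
     (\<forall>t\<ge>0. ereal t < T \<longrightarrow>
        x t \<in> X \<and> (x has_vector_derivative f (x t)) (at t within {0..}))"

text \<open>
  No regularity is imposed on the feedback, so existence of solutions and their continuation to
  all \<open>t \<ge> 0\<close> have to be demanded explicitly; uniqueness is not demanded.
\<close>

definition forward_complete ::
    "('a::real_normed_vector \<Rightarrow> 'a) \<Rightarrow> 'a set \<Rightarrow> 'a set \<Rightarrow> bool" where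
  "forward_complete f X S \<longleftrightarrow>
     (\<forall>p\<in>S. \<exists>x. solution f X \<infinity> x \<and> x 0 = p) \<and>
     (\<forall>T x. solution f X T x \<and> x 0 \<in> S \<longrightarrow>
        (\<exists>y. solution f X \<infinity> y \<and> (\<forall>t\<ge>0. ereal t < T \<longrightarrow> y t = x t)))"

definition forward_invariant ::
    "('a::real_normed_vector \<Rightarrow> 'a) \<Rightarrow> 'a set \<Rightarrow> 'a set \<Rightarrow> bool" where
  "forward_invariant f X S \<longleftrightarrow> forward_complete f X S \<and>
     (\<forall>T x. solution f X T x \<and> x 0 \<in> S \<longrightarrow> (\<forall>t\<ge>0. ereal t < T \<longrightarrow> x t \<in> S))"

text \<open>
  Below, \<open>X\<close> is the state space, \<open>S\<close> the free space, \<open>d\<close> the distance and \<open>p\<close> the target.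
\<close>

definition region_of_attraction ::
    "('a::real_normed_vector \<Rightarrow> 'a) \<Rightarrow> 'a set \<Rightarrow> 'a set \<Rightarrow> ('a \<Rightarrow> 'a \<Rightarrow> real) \<Rightarrow> 'a \<Rightarrow> 'a set" where
  "region_of_attraction f X S d p =
     {q \<in> S. (\<exists>x. solution f X \<infinity> x \<and> x 0 = q) \<and>
        (\<forall>x. solution f X \<infinity> x \<and> x 0 = q \<longrightarrow> ((\<lambda>t. d (x t) p) \<longlongrightarrow> 0) at_top)}"

definition equilibrium :: "('a::real_normed_vector \<Rightarrow> 'a) \<Rightarrow> 'a \<Rightarrow> bool" where
  "equilibrium f p \<longleftrightarrow> f p = 0"

definition stable ::
    "('a::real_normed_vector \<Rightarrow> 'a) \<Rightarrow> 'a set \<Rightarrow> 'a set \<Rightarrow> ('a \<Rightarrow> 'a \<Rightarrow> real) \<Rightarrow> 'a \<Rightarrow> bool" where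
  "stable f X S d p \<longleftrightarrow>
     (\<forall>\<epsilon>>0. \<exists>\<delta>>0. \<forall>x. solution f X \<infinity> x \<and> x 0 \<in> S \<and> d (x 0) p < \<delta> \<longrightarrow>
        (\<forall>t\<ge>0. d (x t) p < \<epsilon>))"

definition attractive ::
    "('a::real_normed_vector \<Rightarrow> 'a) \<Rightarrow> 'a set \<Rightarrow> 'a set \<Rightarrow> ('a \<Rightarrow> 'a \<Rightarrow> real) \<Rightarrow> 'a \<Rightarrow> bool" where
  "attractive f X S d p \<longleftrightarrow>
     (\<exists>\<delta>>0. \<forall>q\<in>S. d q p < \<delta> \<longrightarrow> q \<in> region_of_attraction f X S d p)"

definition exponential_bound ::
    "('a::real_normed_vector \<Rightarrow> 'a) \<Rightarrow> 'a set \<Rightarrow> 'a set \<Rightarrow> ('a \<Rightarrow> 'a \<Rightarrow> real) \<Rightarrow> 'a \<Rightarrow> bool" where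
  "exponential_bound f X S d p \<longleftrightarrow>
     (\<exists>\<delta>>0. \<exists>c>0. \<exists>r>0. \<forall>x. solution f X \<infinity> x \<and> x 0 \<in> S \<and> d (x 0) p < \<delta> \<longrightarrow>
        (\<forall>t\<ge>0. d (x t) p \<le> c * exp (- r * t) * d (x 0) p))"

datatype stability_kind = Asymptotic | Exponential

primrec stable_equilibrium ::
    "stability_kind \<Rightarrow> ('a::real_normed_vector \<Rightarrow> 'a) \<Rightarrow> 'a set \<Rightarrow> 'a set
      \<Rightarrow> ('a \<Rightarrow> 'a \<Rightarrow> real) \<Rightarrow> 'a \<Rightarrow> bool" where
  "stable_equilibrium Asymptotic f X S d p \<longleftrightarrow>
     equilibrium f p \<and> stable f X S d p \<and> attractive f X S d p"
| "stable_equilibrium Exponential f X S d p \<longleftrightarrow>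
     equilibrium f p \<and> exponential_bound f X S d p"

definition sphere_closed_loop ::
    "(real ^ ('n::finite option) \<Rightarrow> real ^ 'm::finite ^ ('n option))
      \<Rightarrow> (real ^ ('n option) \<Rightarrow> real ^ ('n option) \<Rightarrow> real ^ 'm) \<Rightarrow> real ^ ('n option)
      \<Rightarrow> real ^ ('n option) \<Rightarrow> real ^ ('n option)" where
  "sphere_closed_loop P \<kappa> xd x = P x *v \<kappa> x xd"

definition euclid_closed_loop ::
    "(real ^ 'n::finite \<Rightarrow> real ^ 'n \<Rightarrow> real ^ 'n) \<Rightarrow> real ^ 'n \<Rightarrow> real ^ 'n \<Rightarrow> real ^ 'n" where
  "euclid_closed_loop \<kappa> \<xi>d \<xi> = \<kappa> \<xi> \<xi>d"

definition solves_sphere_problem ::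
    "stability_kind \<Rightarrow> (real ^ ('n::finite option) \<Rightarrow> real ^ 'm::finite ^ ('n option))
      \<Rightarrow> (real ^ ('n option)) set
      \<Rightarrow> (real ^ ('n option) \<Rightarrow> real ^ ('n option) \<Rightarrow> real ^ 'm) \<Rightarrow> real ^ ('n option)
      \<Rightarrow> (real ^ ('n option)) set \<Rightarrow> bool" where
  "solves_sphere_problem k P M \<kappa> xd R \<longleftrightarrow>
     forward_invariant (sphere_closed_loop P \<kappa> xd) (sphere 0 1) M \<and>
     stable_equilibrium k (sphere_closed_loop P \<kappa> xd) (sphere 0 1) M geodesic_dist xd \<and>
     R = region_of_attraction (sphere_closed_loop P \<kappa> xd) (sphere 0 1) M geodesic_dist xd"

definition solves_euclid_problem ::
    "stability_kind \<Rightarrow> (real ^ 'n::finite) set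
      \<Rightarrow> (real ^ 'n \<Rightarrow> real ^ 'n \<Rightarrow> real ^ 'n) \<Rightarrow> real ^ 'n \<Rightarrow> (real ^ 'n) set \<Rightarrow> bool" where
  "solves_euclid_problem k M \<kappa> \<xi>d R \<longleftrightarrow>
     forward_invariant (euclid_closed_loop \<kappa> \<xi>d) UNIV M \<and>
     stable_equilibrium k (euclid_closed_loop \<kappa> \<xi>d) UNIV M dist \<xi>d \<and>
     R = region_of_attraction (euclid_closed_loop \<kappa> \<xi>d) UNIV M dist \<xi>d"

text \<open>
  At \<open>x = north\<close> the value below is arbitrary.  Solutions on the sphere are nevertheless not
  barred from \<open>north\<close> by definition; that none starting in the free space reaches it is part of
  forward invariance.
\<close>

definition lifted_law ::
    "(real ^ ('n::finite option) \<Rightarrow> real ^ 'm::finite ^ ('n option))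
      \<Rightarrow> (real ^ 'n \<Rightarrow> real ^ 'n \<Rightarrow> real ^ 'n)
      \<Rightarrow> real ^ ('n option) \<Rightarrow> real ^ ('n option) \<Rightarrow> real ^ 'm" where
  "lifted_law P \<kappa> x xd = right_pinv (Sigma_mat P x) *v \<kappa> (stereo x) (stereo xd)"

end

theory Submission
  imports Defs
begin

text \<open>
  Where \<open>x \<noteq> north\<close>, the Jacobian of the stereographic projection restricts to an isomorphism
  from the tangent space at \<open>x\<close>, which by (A1) is the range of \<open>P x\<close>. Hence \<open>Sigma_mat P x\<close> is
  surjective and the projection conjugates the lifted closed loop to the Euclidean one. The zone
  around \<open>a 0 = north\<close> keeps the free space at a positive distance from \<open>north\<close>, so the
  projection is bi-Lipschitz there, because
  \<open>|stereo x - stereo y|\<^sup>2 (1 - north \<bullet> x) (1 - north \<bullet> y) = |x - y|\<^sup>2\<close>;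
  bi-Lipschitz conjugacies preserve both kinds of stability and the regions of attraction.
\<close>

subsection \<open>Bi-Lipschitz conjugacy of closed loops\<close>

text \<open>Only trajectories are related here, not vector fields. Confinement to \<open>S\<close>
  is a separate assumption (\<open>stays\<close>) because \<open>h\<close> may be a chart on part of
  \<open>X\<close> only: a trajectory must be known to remain in the chart before it can be
  projected. Only distances to the target \<open>p\<close> are compared, with one constant
  \<open>L\<close> serving both directions.\<close>

locale bilipschitz_conjugacy =
  fixes f :: "'a::real_normed_vector \<Rightarrow> 'a" and X S :: "'a set"
    and d :: "'a \<Rightarrow> 'a \<Rightarrow> real" and p :: 'a
    and g :: "'b::real_normed_vector \<Rightarrow> 'b" and h :: "'a \<Rightarrow> 'b" and h' :: "'b \<Rightarrow> 'a"
    and L :: real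
  assumes stays: "\<And>T x t. solution f X T x \<Longrightarrow> x 0 \<in> S \<Longrightarrow> 0 \<le> t \<Longrightarrow> ereal t < T \<Longrightarrow> x t \<in> S"
    and forward: "\<And>T x. solution f X T x \<Longrightarrow> x 0 \<in> S \<Longrightarrow> solution g UNIV T (h \<circ> x)"
    and backward: "\<And>T y. solution g UNIV T y \<Longrightarrow> y 0 \<in> h ` S \<Longrightarrow> solution f X T (h' \<circ> y)"
    and left_inv: "\<And>x. x \<in> S \<Longrightarrow> h' (h x) = x"
    and right_inv: "\<And>y. h (h' y) = y"
    and L_pos: "0 < L"
    and d_nonneg: "\<And>x. x \<in> S \<Longrightarrow> 0 \<le> d x p"
    and d_le: "\<And>x. x \<in> S \<Longrightarrow> d x p \<le> L * dist (h x) (h p)"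
    and dist_le: "\<And>x. x \<in> S \<Longrightarrow> dist (h x) (h p) \<le> L * d x p"
begin

lemma stays': "solution f X \<infinity> x \<Longrightarrow> x 0 \<in> S \<Longrightarrow> 0 \<le> t \<Longrightarrow> x t \<in> S"
  using stays[of \<infinity> x t] by simp

lemma backward_start:
  assumes "solution g UNIV T y" "y 0 = h q" "q \<in> S"
  shows "solution f X T (h' \<circ> y)" "(h' \<circ> y) 0 = q"
  using assms backward[of T y] left_inv by auto

text \<open>To continue a solution that starts in \<open>S\<close>, project it, continue the
  projection for all times, and lift back. The lift agrees with the original on the old interval
  because the original stays in \<open>S\<close>, where \<open>h'\<close> inverts
  \<open>h\<close>.\<close>

lemma forward_invariant_transfer:
  assumes "forward_invariant g UNIV (h ` S)"
  shows "forward_invariant f X S"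
proof -
  have "\<exists>x. solution f X \<infinity> x \<and> x 0 = q" if "q \<in> S" for q
    using assms that backward_start unfolding forward_invariant_def forward_complete_def
    by (metis image_eqI)
  moreover have "\<exists>y. solution f X \<infinity> y \<and> (\<forall>t\<ge>0. ereal t < T \<longrightarrow> y t = x t)"
    if x: "solution f X T x" "x 0 \<in> S" for T x
  proof -
    have "(h \<circ> x) 0 \<in> h ` S"
      using x(2) by simp
    then obtain y where y: "solution g UNIV \<infinity> y" "\<forall>t\<ge>0. ereal t < T \<longrightarrow> y t = (h \<circ> x) t"
      using assms forward[OF x] unfolding forward_invariant_def forward_complete_def by blast
    have "0 < T"
      using x(1) by (simp add: solution_def)
    then have "y 0 = h (x 0)"
      using y(2) by (simp add: zero_ereal_def)
    then have "solution f X \<infinity> (h' \<circ> y)"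
      using backward_start(1)[OF y(1)] x(2) by blast
    then show ?thesis
      using y(2) stays[OF x] left_inv by (intro exI[of _ "h' \<circ> y"]) auto
  qed
  ultimately show ?thesis
    using stays unfolding forward_invariant_def forward_complete_def by blast
qed

lemma tendsto_transfer:
  fixes x :: "real \<Rightarrow> 'a"
  assumes "\<And>t. 0 \<le> t \<Longrightarrow> x t \<in> S"
  shows "((\<lambda>t. d (x t) p) \<longlongrightarrow> 0) at_top \<longleftrightarrow> ((\<lambda>t. dist (h (x t)) (h p)) \<longlongrightarrow> 0) at_top"
proof
  have ev: "\<forall>\<^sub>F t in at_top. x t \<in> S"
    using eventually_ge_at_top[of 0] by eventually_elim (use assms in auto)
  show "((\<lambda>t. d (x t) p) \<longlongrightarrow> 0) at_top"
    if "((\<lambda>t. dist (h (x t)) (h p)) \<longlongrightarrow> 0) at_top"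
  proof (rule tendsto_sandwich[OF _ _ tendsto_const])
    show "\<forall>\<^sub>F t in at_top. 0 \<le> d (x t) p"
      using ev by eventually_elim (rule d_nonneg)
    show "\<forall>\<^sub>F t in at_top. d (x t) p \<le> L * dist (h (x t)) (h p)"
      using ev by eventually_elim (rule d_le)
    show "((\<lambda>t. L * dist (h (x t)) (h p)) \<longlongrightarrow> 0) at_top"
      using tendsto_mult_left[OF that, of L] by simp
  qed
  show "((\<lambda>t. dist (h (x t)) (h p)) \<longlongrightarrow> 0) at_top"
    if "((\<lambda>t. d (x t) p) \<longlongrightarrow> 0) at_top"
  proof (rule tendsto_sandwich[OF _ _ tendsto_const])
    show "\<forall>\<^sub>F t in at_top. dist (h (x t)) (h p) \<le> L * d (x t) p"
      using ev by eventually_elim (rule dist_le)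
    show "((\<lambda>t. L * d (x t) p) \<longlongrightarrow> 0) at_top"
      using tendsto_mult_left[OF that, of L] by simp
  qed simp
qed

text \<open>Solutions need not be unique, so membership combines existence of a solution with
  convergence of every solution. Each inclusion therefore uses both transports: one carries the
  existing solution over, the other pulls an arbitrary solution back to one whose convergence is
  known.\<close>

lemma region_of_attraction_transfer:
  "region_of_attraction f X S d p =
    {q \<in> S. h q \<in> region_of_attraction g UNIV (h ` S) dist (h p)}"
proof (intro set_eqI iffI)
  fix q
  assume "q \<in> region_of_attraction f X S d p"
  then obtain x where q: "q \<in> S" and x: "solution f X \<infinity> x" "x 0 = q"
    and lim: "\<And>x. solution f X \<infinity> x \<Longrightarrow> x 0 = q \<Longrightarrow> ((\<lambda>t. d (x t) p) \<longlongrightarrow> 0) at_top"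
    unfolding region_of_attraction_def by blast
  have "((\<lambda>t. dist (y t) (h p)) \<longlongrightarrow> 0) at_top" if y: "solution g UNIV \<infinity> y" "y 0 = h q" for y
  proof -
    note x' = backward_start[OF y q]
    have "((\<lambda>t. dist (h ((h' \<circ> y) t)) (h p)) \<longlongrightarrow> 0) at_top"
      using lim[OF x'] stays'[OF x'(1)] x'(2) q tendsto_transfer[of "h' \<circ> y"] by simp
    then show ?thesis
      by (simp add: right_inv)
  qed
  moreover have "solution g UNIV \<infinity> (h \<circ> x)" "(h \<circ> x) 0 = h q"
    using forward[OF x(1)] x(2) q by auto
  ultimately show "q \<in> {q \<in> S. h q \<in> region_of_attraction g UNIV (h ` S) dist (h p)}"
    using q unfolding region_of_attraction_def by blast
next
  fix q
  assume "q \<in> {q \<in> S. h q \<in> region_of_attraction g UNIV (h ` S) dist (h p)}"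
  then obtain y where q: "q \<in> S" and y: "solution g UNIV \<infinity> y" "y 0 = h q"
    and lim: "\<And>y. solution g UNIV \<infinity> y \<Longrightarrow> y 0 = h q \<Longrightarrow> ((\<lambda>t. dist (y t) (h p)) \<longlongrightarrow> 0) at_top"
    unfolding region_of_attraction_def by blast
  have "((\<lambda>t. d (x t) p) \<longlongrightarrow> 0) at_top" if x: "solution f X \<infinity> x" "x 0 = q" for x
    using lim[OF forward[OF x(1)]] x(2) q stays'[OF x(1)] tendsto_transfer[of x] by simp
  then show "q \<in> region_of_attraction f X S d p"
    using q backward_start[OF y q] unfolding region_of_attraction_def by blast
qed

lemma stable_transfer:
  assumes "stable g UNIV (h ` S) dist (h p)"
  shows "stable f X S d p"
  unfolding stable_def
proof (intro allI impI)
  fix \<epsilon> :: real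
  assume "\<epsilon> > 0"
  \<comment> \<open>Each passage through \<open>h\<close> costs at most a factor \<open>L\<close>:
    the tolerance becomes \<epsilon> / L for the projected system, and the \<delta> found there
    becomes \<delta> / L.\<close>
  then have "\<epsilon> / L > 0"
    using L_pos by simp
  then obtain \<delta> where "\<delta> > 0" and \<delta>: "\<And>y t. solution g UNIV \<infinity> y \<Longrightarrow> y 0 \<in> h ` S \<Longrightarrow>
      dist (y 0) (h p) < \<delta> \<Longrightarrow> 0 \<le> t \<Longrightarrow> dist (y t) (h p) < \<epsilon> / L"
    using assms unfolding stable_def by meson
  have "d (x t) p < \<epsilon>"
    if x: "solution f X \<infinity> x" "x 0 \<in> S" "d (x 0) p < \<delta> / L" and t: "0 \<le> t" for x t
  proof -
    have "L * d (x 0) p < \<delta>"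
      using x(3) L_pos by (simp add: field_simps)
    then have "dist (h (x 0)) (h p) < \<delta>"
      using dist_le[OF x(2)] by linarith
    then have "L * dist (h (x t)) (h p) < \<epsilon>"
      using \<delta>[OF forward[OF x(1,2)] _ _ t] x(2) L_pos by (simp add: field_simps)
    then show ?thesis
      using d_le[OF stays'[OF x(1,2) t]] by linarith
  qed
  then show "\<exists>\<delta>>0. \<forall>x. solution f X \<infinity> x \<and> x 0 \<in> S \<and> d (x 0) p < \<delta> \<longrightarrow>
        (\<forall>t\<ge>0. d (x t) p < \<epsilon>)"
    using \<open>\<delta> > 0\<close> L_pos by (intro exI[of _ "\<delta> / L"]) auto
qed

lemma attractive_transfer:
  assumes "attractive g UNIV (h ` S) dist (h p)"
  shows "attractive f X S d p"
proof -
  obtain \<delta> where "\<delta> > 0" and \<delta>: "\<And>q. q \<in> S \<Longrightarrow> dist (h q) (h p) < \<delta> \<Longrightarrow>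
      h q \<in> region_of_attraction g UNIV (h ` S) dist (h p)"
    using assms unfolding attractive_def by blast
  have "q \<in> region_of_attraction f X S d p" if q: "q \<in> S" "d q p < \<delta> / L" for q
  proof -
    have "L * d q p < \<delta>"
      using q(2) L_pos by (simp add: field_simps)
    then show ?thesis
      using \<delta>[OF q(1)] dist_le[OF q(1)] q(1) by (simp add: region_of_attraction_transfer)
  qed
  then show ?thesis
    using \<open>\<delta> > 0\<close> L_pos unfolding attractive_def by (intro exI[of _ "\<delta> / L"]) auto
qed

lemma exponential_bound_transfer:
  assumes "exponential_bound g UNIV (h ` S) dist (h p)"
  shows "exponential_bound f X S d p"
proof -
  obtain \<delta> c r where pos: "\<delta> > 0" "c > 0" "r > 0"
    and *: "\<And>y t. solution g UNIV \<infinity> y \<Longrightarrow> y 0 \<in> h ` S \<Longrightarrow>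
      dist (y 0) (h p) < \<delta> \<Longrightarrow> 0 \<le> t \<Longrightarrow> dist (y t) (h p) \<le> c * exp (- r * t) * dist (y 0) (h p)"
    using assms unfolding exponential_bound_def by meson
  \<comment> \<open>One factor \<open>L\<close> compares distances at time \<open>t\<close>, the
    other at time 0; the rate \<open>r\<close> is unchanged.\<close>
  have "d (x t) p \<le> (L * c * L) * exp (- r * t) * d (x 0) p"
    if x: "solution f X \<infinity> x" "x 0 \<in> S" "d (x 0) p < \<delta> / L" and t: "0 \<le> t" for x t
  proof -
    have "L * d (x 0) p < \<delta>"
      using x(3) L_pos by (simp add: field_simps)
    then have "dist (h (x 0)) (h p) < \<delta>"
      using dist_le[OF x(2)] by linarith
    then have "dist (h (x t)) (h p) \<le> c * exp (- r * t) * dist (h (x 0)) (h p)"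
      using *[OF forward[OF x(1,2)] _ _ t] x(2) by simp
    also have "\<dots> \<le> c * exp (- r * t) * (L * d (x 0) p)"
      using dist_le[OF x(2)] pos by (intro mult_left_mono) auto
    finally have "L * dist (h (x t)) (h p) \<le> L * (c * exp (- r * t) * (L * d (x 0) p))"
      using L_pos by simp
    then show ?thesis
      using d_le[OF stays'[OF x(1,2) t]] by (simp add: mult_ac)
  qed
  then show ?thesis
    using pos L_pos unfolding exponential_bound_def
    by (intro exI[of _ "\<delta> / L"] exI[of _ "L * c * L"] exI[of _ r] conjI) auto
qed

lemma stable_equilibrium_transfer:
  assumes "stable_equilibrium k g UNIV (h ` S) dist (h p)" and "equilibrium f p"
  shows "stable_equilibrium k f X S d p"
  using assms stable_transfer attractive_transfer exponential_bound_transfer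
  by (cases k) simp_all

end

subsection \<open>Right pseudoinverses\<close>

lemma matrix_inv_right:
  fixes A :: "real ^ 'n ^ 'n"
  assumes "invertible A"
  shows "A ** matrix_inv A = mat 1"
  using someI_ex[of "\<lambda>B. A ** B = mat 1 \<and> B ** A = mat 1"] assms
  unfolding invertible_def matrix_inv_def by blast

text \<open>The Gram matrix A A^T has trivial kernel: if A A^T w = 0 then |A^T w|^2 = 0, so w is
  orthogonal to the range of A, which is the whole space.\<close>

lemma right_pinv_right_inverse:
  fixes A :: "real ^ 'm::finite ^ 'n::finite"
  assumes "surj ((*v) A)"
  shows "A ** right_pinv A = mat 1"
proof -
  have "w = 0" if "(A ** transpose A) *v w = 0" for w
  proof -
    obtain u where u: "w = A *v u"
      using assms by (meson surjD)
    have "(transpose A *v w) \<bullet> (transpose A *v w) = w \<bullet> ((A ** transpose A) *v w)"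
      by (metis dot_lmul_matrix matrix_vector_mul_assoc transpose_matrix_vector)
    then have "transpose A *v w = 0"
      using that by simp
    then have "w \<bullet> w = 0"
      by (metis dot_lmul_matrix inner_zero_left transpose_matrix_vector u)
    then show ?thesis by simp
  qed
  then have "invertible (A ** transpose A)"
    using matrix_left_invertible_ker invertible_left_inverse by blast
  then show ?thesis
    by (simp add: right_pinv_def matrix_mul_assoc matrix_inv_right)
qed

text \<open>Here \<sigma> is a lower bound for the singular values of A^T. With u = A^T z and A u =
  v, one has |u|^2 = z . v <= |z| |v| <= (|u| / \<sigma>) |v|, and a factor |u| cancels.\<close>

lemma norm_right_pinv_le:
  fixes A :: "real ^ 'm::finite ^ 'n::finite"
  assumes "surj ((*v) A)" and "0 < \<sigma>" and \<sigma>: "\<And>w. \<sigma> * norm w \<le> norm (transpose A *v w)"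
  shows "norm (right_pinv A *v v) \<le> norm v / \<sigma>"
proof -
  define z where "z = matrix_inv (A ** transpose A) *v v"
  define u where "u = transpose A *v z"
  have pinv: "right_pinv A *v v = u"
    by (simp add: right_pinv_def u_def z_def matrix_vector_mul_assoc)
  have "A *v u = v"
    using right_pinv_right_inverse[OF assms(1)]
    by (simp add: pinv[symmetric] matrix_vector_mul_assoc)
  then have "norm u * norm u = z \<bullet> v"
    by (metis dot_lmul_matrix power2_eq_square power2_norm_eq_inner transpose_matrix_vector u_def)
  also have "\<dots> \<le> norm z * norm v"
    by (rule norm_cauchy_schwarz)
  also have "\<dots> \<le> (norm u / \<sigma>) * norm v"
    using \<sigma>[of z] \<open>0 < \<sigma>\<close> by (intro mult_right_mono) (auto simp: u_def field_simps)
  finally have "norm u * norm u \<le> norm u * (norm v / \<sigma>)"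
    by simp
  then have "norm u \<le> norm v / \<sigma>"
    using \<open>0 < \<sigma>\<close> by (cases "u = 0") (simp_all del: times_divide_eq_right)
  then show ?thesis
    by (simp add: pinv)
qed

subsection \<open>Geometry of the stereographic projection\<close>

lemma dist_unit_vectors:
  fixes x y :: "'a::real_inner"
  assumes "norm x = 1" "norm y = 1"
  shows "(dist x y)\<^sup>2 = 2 - 2 * (x \<bullet> y)"
  using assms unfolding dist_norm power2_norm_eq_inner
  by (simp add: inner_diff inner_commute norm_eq_1)

text \<open>The difference \<open>sin t - t * cos t\<close> vanishes at 0 and has derivative
  \<open>t * sin t\<close>, which is nonnegative on [0, pi].\<close>

lemma mult_cos_le_sin:
  fixes u :: real
  assumes "0 \<le> u" "u \<le> pi"
  shows "u * cos u \<le> sin u"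
proof -
  have "sin 0 - 0 * cos 0 \<le> sin u - u * cos u"
  proof (rule DERIV_nonneg_imp_nondecreasing[OF assms(1)])
    fix t
    assume "0 \<le> t" "t \<le> u"
    then have "0 \<le> t * sin t"
      using assms by (intro mult_nonneg_nonneg sin_ge_zero) auto
    moreover have "((\<lambda>t. sin t - t * cos t) has_real_derivative t * sin t) (at t)"
      by (auto intro!: derivative_eq_intros)
    ultimately show "\<exists>y. ((\<lambda>t. sin t - t * cos t) has_real_derivative y) (at t) \<and> 0 \<le> y"
      by blast
  qed
  then show ?thesis by simp
qed

lemma
  fixes x y :: "real ^ ('n::finite option)"
  assumes "norm x = 1" "norm y = 1"
  shows dist_le_geodesic_dist: "dist x y \<le> geodesic_dist x y"
    and geodesic_dist_le_dist: "geodesic_dist x y \<le> 2 * dist x y"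
    and geodesic_dist_nonneg: "0 \<le> geodesic_dist x y"
proof -
  \<comment> \<open>A quarter of the angle keeps u in [0, pi/4] even for antipodal points, so cos^2
    u >= 1/2. Half the chord is then sin (2 u) = 2 sin u cos u >= 2 u cos^2 u >= u, which yields the
    factor 2 in the second bound.\<close>
  define u where "u = geodesic_dist x y / 4"
  have "\<bar>x \<bullet> y\<bar> \<le> 1"
    using Cauchy_Schwarz_ineq2[of x y] assms by simp
  then have rng: "0 \<le> u" "u \<le> pi / 4" and cos: "cos (4 * u) = x \<bullet> y"
    using arccos_lbound[of "x \<bullet> y"] arccos_ubound[of "x \<bullet> y"]
    by (auto simp: u_def geodesic_dist_def intro!: cos_arccos_abs)
  have "(dist x y)\<^sup>2 = 2 - 2 * cos (4 * u)"
    using dist_unit_vectors[OF assms] by (simp add: cos)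
  also have "\<dots> = (2 * sin (2 * u))\<^sup>2"
    using cos_double_sin[of "2 * u"] by (simp add: power_mult_distrib)
  finally have chord: "dist x y = 2 * sin (2 * u)"
    by (rule power2_eq_imp_eq) (use rng sin_ge_zero[of "2 * u"] in simp_all)
  show "dist x y \<le> geodesic_dist x y"
    using sin_x_le_x[of "2 * u"] rng by (simp add: chord) (simp add: u_def)
  have "cos (pi / 4) \<le> cos u"
    using rng by (intro cos_monotone_0_pi_le) auto
  then have "(cos (pi / 4))\<^sup>2 \<le> (cos u)\<^sup>2"
    by (intro power_mono) (auto simp: cos_45)
  then have "1 / 2 \<le> (cos u)\<^sup>2"
    by (simp add: cos_45 power_divide)
  then have "2 * u * (1 / 2) \<le> 2 * u * (cos u)\<^sup>2"
    using rng by (intro mult_left_mono) auto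
  also have "\<dots> = 2 * (u * cos u) * cos u"
    by (simp add: power2_eq_square)
  also have "\<dots> \<le> 2 * sin u * cos u"
    using mult_cos_le_sin[of u] rng cos_ge_zero[of u] by (intro mult_right_mono) auto
  also have "\<dots> = dist x y / 2"
    using chord by (simp add: sin_double)
  finally show "geodesic_dist x y \<le> 2 * dist x y"
    by (simp add: u_def)
  show "0 \<le> geodesic_dist x y"
    using rng by (simp add: u_def)
qed

section \<open>Coordinates and the distance identity\<close>

lemma north_inner: "north \<bullet> x = x $ None"
  by (simp add: north_def inner_axis')

lemma norm_north [simp]: "norm north = 1"
  by (simp add: north_def norm_axis_1)

lemma J_mat_mult_nth: "(J_mat *v x) $ i = x $ Some i"
  by (simp add: J_mat_def matrix_vector_mult_def if_distrib[of "\<lambda>c. c * _"] cong: if_cong)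

lemma vec_J_mat_mult_nth:
  "(\<xi> v* J_mat) $ None = 0"
  "(\<xi> v* J_mat) $ Some i = \<xi> $ i"
  by (simp_all add: J_mat_def vector_matrix_mult_def if_distrib[of "\<lambda>c. _ * c"] cong: if_cong)

lemma inner_option_vec:
  fixes x y :: "real ^ ('n::finite option)"
  shows "x \<bullet> y = x $ None * y $ None + (J_mat *v x) \<bullet> (J_mat *v y)"
  by (simp add: inner_vec_def UNIV_option_conv sum.reindex J_mat_mult_nth)

lemma north_inner_less_1:
  assumes "norm x = 1" "x \<noteq> north"
  shows "north \<bullet> x < 1"
proof -
  have "0 < (dist north x)\<^sup>2"
    using assms(2) by simp
  then show ?thesis
    using dist_unit_vectors[OF norm_north assms(1)] by linarith
qed

text \<open>Split x and y into last coordinates s, t and remaining parts u, v. Unit length gives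
  |u|^2 = (1 + s)(1 - s) and |v|^2 = (1 + t)(1 - t), so one factor of each squared denominator
  cancels, and clearing the rest leaves 2 - 2 (x . y).\<close>

lemma dist_stereo:
  assumes "norm x = 1" "norm y = 1" "north \<bullet> x \<noteq> 1" "north \<bullet> y \<noteq> 1"
  shows "(dist (stereo x) (stereo y))\<^sup>2 * ((1 - north \<bullet> x) * (1 - north \<bullet> y)) = (dist x y)\<^sup>2"
proof -
  have common_denominator: "(A / a - B / (a * b) + C / b) * (a * b) = A * b - B + C * a"
    if "a \<noteq> 0" "b \<noteq> 0" for A B C a b :: real
    using that by (simp add: field_simps)
  define s t where "s = x $ None" and "t = y $ None"
  define u v where "u = J_mat *v x" and "v = J_mat *v y"
  have nz: "1 - s \<noteq> 0" "1 - t \<noteq> 0"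
    using assms(3,4) by (simp_all add: north_inner s_def t_def)
  have uu: "u \<bullet> u = (1 + s) * (1 - s)" and vv: "v \<bullet> v = (1 + t) * (1 - t)"
    and uv: "u \<bullet> v = x \<bullet> y - s * t"
    using assms(1,2) inner_option_vec[of x x] inner_option_vec[of y y] inner_option_vec[of x y]
    by (simp_all add: norm_eq_1 s_def t_def u_def v_def algebra_simps)
  have "(dist (stereo x) (stereo y))\<^sup>2 =
      (u \<bullet> u) / (1 - s)\<^sup>2 - 2 * (u \<bullet> v) / ((1 - s) * (1 - t)) + (v \<bullet> v) / (1 - t)\<^sup>2"
    unfolding dist_norm power2_norm_eq_inner stereo_def north_inner
      s_def[symmetric] t_def[symmetric] u_def[symmetric] v_def[symmetric]
    by (simp add: inner_diff inner_commute power2_eq_square field_simps)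
  also have "\<dots> = (1 + s) / (1 - s) - 2 * (x \<bullet> y - s * t) / ((1 - s) * (1 - t)) + (1 + t) / (1 - t)"
    using nz by (simp add: uu vv uv power2_eq_square)
  also have "\<dots> * ((1 - s) * (1 - t)) =
      (1 + s) * (1 - t) - 2 * (x \<bullet> y - s * t) + (1 + t) * (1 - s)"
    by (rule common_denominator[OF nz])
  also have "\<dots> = 2 - 2 * (x \<bullet> y)"
    by (simp add: algebra_simps)
  finally show ?thesis
    using dist_unit_vectors[OF assms(1,2)] by (simp add: north_inner s_def t_def)
qed

section \<open>The inverse projection\<close>

definition inverse_stereo :: "real ^ 'n::finite \<Rightarrow> real ^ ('n option)" where
  "inverse_stereo \<xi> =
     (1 / (1 + \<xi> \<bullet> \<xi>)) *\<^sub>R (2 *\<^sub>R (\<xi> v* J_mat) + (\<xi> \<bullet> \<xi> - 1) *\<^sub>R north)"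

lemma one_plus_inner_pos: "0 < 1 + \<xi> \<bullet> (\<xi> :: 'a::real_inner)"
  by (rule add_pos_nonneg) auto

lemma inverse_stereo_None: "inverse_stereo \<xi> $ None = (\<xi> \<bullet> \<xi> - 1) / (1 + \<xi> \<bullet> \<xi>)"
  by (simp add: inverse_stereo_def vec_J_mat_mult_nth north_def axis_def)

lemma J_mat_inverse_stereo: "J_mat *v inverse_stereo \<xi> = (2 / (1 + \<xi> \<bullet> \<xi>)) *\<^sub>R \<xi>"
  by (simp add: vec_eq_iff J_mat_mult_nth inverse_stereo_def vec_J_mat_mult_nth
      north_def axis_def)

lemma inverse_stereo_inner: "inverse_stereo \<xi> \<bullet> inverse_stereo \<xi> = 1"
proof -
  define q where "q = \<xi> \<bullet> \<xi>"
  have q: "1 + q \<noteq> 0"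
    using one_plus_inner_pos[of \<xi>] by (simp add: q_def)
  have "inverse_stereo \<xi> \<bullet> inverse_stereo \<xi> = ((q - 1)\<^sup>2 + 4 * q) / (1 + q)\<^sup>2"
    unfolding inner_option_vec[of "inverse_stereo \<xi>"] inverse_stereo_None J_mat_inverse_stereo
    by (simp add: q_def[symmetric] power2_eq_square add_divide_distrib)
  also have "(q - 1)\<^sup>2 + 4 * q = (1 + q)\<^sup>2"
    by (simp add: power2_eq_square algebra_simps)
  finally show ?thesis
    using q by simp
qed

lemma norm_inverse_stereo [simp]: "norm (inverse_stereo \<xi>) = 1"
  by (simp add: norm_eq_1 inverse_stereo_inner)

lemma one_minus_north_inverse_stereo: "1 - north \<bullet> inverse_stereo \<xi> = 2 / (1 + \<xi> \<bullet> \<xi>)"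
  using one_plus_inner_pos[of \<xi>] by (simp add: north_inner inverse_stereo_None field_simps)

lemma inverse_stereo_neq_north: "inverse_stereo \<xi> \<noteq> north"
proof
  assume "inverse_stereo \<xi> = north"
  then have "2 / (1 + \<xi> \<bullet> \<xi>) = 0"
    using one_minus_north_inverse_stereo[of \<xi>] norm_north[unfolded norm_eq_1, where 'a = 'a]
    by simp
  then show False
    using one_plus_inner_pos[of \<xi>] by simp
qed

lemma stereo_inverse_stereo: "stereo (inverse_stereo \<xi>) = \<xi>"
  using one_plus_inner_pos[of \<xi>]
  by (simp add: stereo_def one_minus_north_inverse_stereo J_mat_inverse_stereo del: scaleR_scaleR)
    (simp add: field_simps)

text \<open>Both points have the same projection, so the identity \<open>dist_stereo\<close> makes
  their distance zero.\<close>

lemma inverse_stereo_stereo: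
  assumes "norm x = 1" "x \<noteq> north"
  shows "inverse_stereo (stereo x) = x"
proof -
  have "(dist (inverse_stereo (stereo x)) x)\<^sup>2 = 0"
    using dist_stereo[of "inverse_stereo (stereo x)" x] assms
      north_inner_less_1[OF assms] inverse_stereo_neq_north[of "stereo x"]
      north_inner_less_1[of "inverse_stereo (stereo x)"]
    by (simp add: stereo_inverse_stereo)
  then show ?thesis
    by simp
qed

lemma inverse_stereo_differentiable: "inverse_stereo differentiable (at \<xi>)"
proof -
  have "bounded_linear (\<lambda>y. transpose J_mat *v y)"
    by (rule matrix_vector_mul_bounded_linear)
  then have lin: "((\<lambda>y. y v* J_mat) has_derivative (\<lambda>h. h v* J_mat)) (at \<xi>)"
    by (intro bounded_linear_imp_has_derivative) simp
  have nz: "1 + \<xi> \<bullet> \<xi> \<noteq> 0"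
    using one_plus_inner_pos[of \<xi>] by simp
  show ?thesis
    unfolding inverse_stereo_def[abs_def]
    by (rule differentiableI, (rule derivative_intros lin nz)+)
qed

section \<open>The derivative on tangent spaces\<close>

lemma dim_tangent_space:
  fixes x :: "real ^ ('n::finite option)"
  assumes "norm x = 1"
  shows "dim (tangent_space x) = CARD('n)"
proof -
  have "x \<noteq> 0"
    using assms by auto
  moreover have "tangent_space x = {z. x \<bullet> z = 0}"
    by (auto simp: tangent_space_def inner_commute)
  ultimately show ?thesis
    by (simp add: dim_hyperplane)
qed

lemma subspace_tangent_space: "subspace (tangent_space x)"
  by (simp add: subspace_def tangent_space_def inner_add_left)

text \<open>No formula for D is needed. Differentiating |\<open>inverse_stereo\<close>|^2 = 1 makes
  its values tangent, and the chain rule for \<open>stereo\<close> after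
  \<open>inverse_stereo\<close> gives the left inverse. Hence D is injective, its range fills the
  tangent space by dimension, and the one-sided inverse is two-sided there.\<close>

lemma stereo_tangent_iso:
  fixes x :: "real ^ ('n::finite option)"
  assumes "norm x = 1" "x \<noteq> north"
  obtains D where "(inverse_stereo has_derivative D) (at (stereo x))"
    and "\<And>w. D w \<in> tangent_space x"
    and "\<And>w. stereo_jacobian x *v D w = w"
    and "\<And>z. z \<in> tangent_space x \<Longrightarrow> D (stereo_jacobian x *v z) = z"
proof -
  obtain D where D: "(inverse_stereo has_derivative D) (at (stereo x))"
    using inverse_stereo_differentiable unfolding differentiable_def by blast
  interpret D: linear D
    using D by (rule has_derivative_linear)
  note inv = inverse_stereo_stereo[OF assms]
  have "((\<lambda>\<xi>. inverse_stereo \<xi> \<bullet> inverse_stereo \<xi>) has_derivative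
      (\<lambda>w. x \<bullet> D w + D w \<bullet> x)) (at (stereo x))"
    using has_derivative_inner[OF D D] by (simp add: inv)
  moreover have "((\<lambda>\<xi>. inverse_stereo \<xi> \<bullet> inverse_stereo \<xi>) has_derivative (\<lambda>w. 0)) (at (stereo x))"
    by (simp add: inverse_stereo_inner)
  ultimately have "(\<lambda>w. x \<bullet> D w + D w \<bullet> x) = (\<lambda>w. 0)"
    by (rule has_derivative_unique)
  then have tangent: "D w \<in> tangent_space x" for w
    by (simp add: fun_eq_iff tangent_space_def inner_commute)
  have "(stereo has_derivative (\<lambda>h. stereo_jacobian x *v h)) (at (inverse_stereo (stereo x)))"
    using stereo_has_derivative[of x] north_inner_less_1[OF assms] by (simp add: inv)
  from diff_chain_at[OF D this]
  have "((\<lambda>\<xi>. \<xi>) has_derivative (\<lambda>w. stereo_jacobian x *v D w)) (at (stereo x))"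
    by (simp add: comp_def stereo_inverse_stereo)
  then have "(\<lambda>w. stereo_jacobian x *v D w) = (\<lambda>w. w)"
    using has_derivative_ident by (rule has_derivative_unique)
  then have left_inv: "stereo_jacobian x *v D w = w" for w
    by (rule fun_cong)
  then have "inj D"
    by (metis injI)
  then have "dim (range D) = CARD('n)"
    using dim_image_eq[of D UNIV] D.linear_axioms by simp
  then have "range D = tangent_space x"
    using tangent dim_tangent_space[OF assms(1)]
    by (intro subspace_dim_equal subspace_tangent_space linear_subspace_image[OF D.linear_axioms subspace_UNIV]) auto
  then have "D (stereo_jacobian x *v z) = z" if "z \<in> tangent_space x" for z
    using that left_inv by (metis imageE)
  with D tangent left_inv show ?thesis
    by (rule that)
qed

subsection \<open>The lifted closed loop\<close>

lemma continuous_on_matrix_mult: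
  fixes A :: "'a::topological_space \<Rightarrow> real ^ 'n ^ 'm" and B :: "'a \<Rightarrow> real ^ 'p ^ 'n"
  assumes "continuous_on S A" "continuous_on S B"
  shows "continuous_on S (\<lambda>x. A x ** B x)"
  unfolding matrix_matrix_mult_def
  by (intro continuous_on_vec_lambda continuous_on_sum continuous_on_mult
      continuous_on_component assms)

lemma continuous_on_stereo_jacobian:
  assumes "\<And>x. x \<in> S \<Longrightarrow> north \<bullet> x \<noteq> 1"
  shows "continuous_on S (stereo_jacobian :: real ^ ('n::finite option) \<Rightarrow> _)"
proof -
  have "continuous_on S (\<lambda>x. columnvector x :: real ^ 1 ^ ('n option))"
    unfolding columnvector_def
    by (intro continuous_on_vec_lambda continuous_on_component continuous_on_id)
  then show ?thesis
    unfolding stereo_jacobian_def[abs_def]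
    by (intro continuous_intros continuous_on_matrix_mult) (use assms in auto)
qed

text \<open>The conic zones enter only through a closed set \<open>M\<close> on the sphere and a gap
  \<open>c\<close> separating it from \<open>north\<close> in height. Invariance of the projected
  system is included because it is what keeps lifted solutions away from
  \<open>north\<close>.\<close>

locale lifted_system =
  fixes P :: "real ^ ('n::finite option) \<Rightarrow> real ^ 'm::finite ^ ('n option)"
    and M :: "(real ^ ('n option)) set" and c :: real
    and \<kappa> :: "real ^ 'n \<Rightarrow> real ^ 'n \<Rightarrow> real ^ 'n"
    and xd :: "real ^ ('n option)"
  assumes continuous_P: "continuous_on UNIV P"
    and P_tangent: "\<And>x u. norm x = 1 \<Longrightarrow> P x *v u \<in> tangent_space x"
    and rank_P: "\<And>x. norm x = 1 \<Longrightarrow> x \<noteq> north \<Longrightarrow> rank (P x) = CARD('n)"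
    and closed_M: "closed M" and M_sphere: "M \<subseteq> sphere 0 1"
    and c_pos: "0 < c" and M_away: "\<And>x. x \<in> M \<Longrightarrow> c \<le> 1 - north \<bullet> x"
    and xd_in: "xd \<in> M"
    and invariant: "forward_invariant (euclid_closed_loop \<kappa> (stereo xd)) UNIV (stereo ` M)"
begin

abbreviation "F \<equiv> sphere_closed_loop P (lifted_law P \<kappa>) xd"
abbreviation "G \<equiv> euclid_closed_loop \<kappa> (stereo xd)"

lemma M_D:
  assumes "x \<in> M"
  shows "norm x = 1" "x \<noteq> north"
proof -
  show "norm x = 1"
    using assms M_sphere by auto
  show "x \<noteq> north"
    using M_away[OF assms] c_pos norm_north[unfolded norm_eq_1, where 'a = 'n] by auto
qed

lemma in_M_if_stereo_in:
  assumes "norm x = 1" "x \<noteq> north" "stereo x \<in> stereo ` M"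
  shows "x \<in> M"
proof -
  obtain q where q: "q \<in> M" "stereo x = stereo q"
    using assms(3) by auto
  have "x = inverse_stereo (stereo q)"
    using inverse_stereo_stereo[OF assms(1,2)] q(2) by simp
  then show ?thesis
    using inverse_stereo_stereo[OF M_D[OF q(1)]] q(1) by simp
qed

text \<open>By dimension, the range of \<open>P x\<close> is the whole tangent space; it therefore
  contains \<open>D w\<close>, which the Jacobian maps to \<open>w\<close>.\<close>

lemma surj_Sigma_mat:
  assumes "norm x = 1" "x \<noteq> north"
  shows "surj ((*v) (Sigma_mat P x))"
proof -
  obtain D where D: "\<And>w. D w \<in> tangent_space x" "\<And>w. stereo_jacobian x *v D w = w"
    using stereo_tangent_iso[OF assms] by metis
  have "dim (range ((*v) (P x))) = CARD('n)"
    using rank_P[OF assms] by (simp add: rank_dim_range)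
  moreover have "subspace (range ((*v) (P x)))"
    by (rule linear_subspace_image[OF matrix_vector_mul_linear subspace_UNIV])
  moreover have "range ((*v) (P x)) \<subseteq> tangent_space x"
    using P_tangent[OF assms(1)] by auto
  ultimately have "range ((*v) (P x)) = tangent_space x"
    using dim_tangent_space[OF assms(1)] by (simp add: subspace_dim_equal subspace_tangent_space)
  then have "\<exists>u. w = Sigma_mat P x *v u" for w
  proof -
    have "D w \<in> range ((*v) (P x))"
      using D(1) \<open>range ((*v) (P x)) = tangent_space x\<close> by simp
    then obtain u where "D w = P x *v u"
      by blast
    then have "w = Sigma_mat P x *v u"
      using D(2)[of w] by (simp add: Sigma_mat_def matrix_vector_mul_assoc)
    then show ?thesis ..
  qed
  then show ?thesis
    by (simp add: surj_def)
qed

lemma stereo_jacobian_F: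
  assumes "norm x = 1" "x \<noteq> north"
  shows "stereo_jacobian x *v F x = G (stereo x)"
proof -
  have "stereo_jacobian x *v F x =
      (Sigma_mat P x ** right_pinv (Sigma_mat P x)) *v \<kappa> (stereo x) (stereo xd)"
    by (simp add: sphere_closed_loop_def lifted_law_def Sigma_mat_def
        matrix_vector_mul_assoc matrix_mul_assoc)
  then show ?thesis
    by (simp add: right_pinv_right_inverse surj_Sigma_mat assms euclid_closed_loop_def)
qed

lemma solution_stereo:
  assumes "solution F (sphere 0 1) T x"
    and "\<And>t. 0 \<le> t \<Longrightarrow> ereal t < T \<Longrightarrow> x t \<noteq> north"
  shows "solution G UNIV T (stereo \<circ> x)"
proof -
  have "((stereo \<circ> x) has_vector_derivative G (stereo (x t))) (at t within {0..})"
    if t: "0 \<le> t" "ereal t < T" for t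
  proof -
    have x: "norm (x t) = 1" "x t \<noteq> north"
      and x': "(x has_vector_derivative F (x t)) (at t within {0..})"
      using assms t unfolding solution_def by auto
    have "(stereo has_derivative (\<lambda>h. stereo_jacobian (x t) *v h)) (at (x t))"
      using stereo_has_derivative[of "x t"] north_inner_less_1[OF x] by simp
    then have "(stereo has_derivative (\<lambda>h. stereo_jacobian (x t) *v h)) (at (x t) within x ` {0..})"
      by (rule has_derivative_at_withinI)
    from vector_derivative_diff_chain_within[OF x' this] show ?thesis
      by (simp add: stereo_jacobian_F[OF x])
  qed
  then show ?thesis
    using assms(1) by (simp add: solution_def)
qed

text \<open>The chain rule gives the velocity D (G (y t)), and G (y t) is the Jacobian applied to
  the tangent vector F x. On tangent vectors D undoes the Jacobian, leaving F x.\<close>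

lemma solution_inverse_stereo:
  assumes "solution G UNIV T y"
  shows "solution F (sphere 0 1) T (inverse_stereo \<circ> y)"
proof -
  have "((inverse_stereo \<circ> y) has_vector_derivative F (inverse_stereo (y t))) (at t within {0..})"
    if t: "0 \<le> t" "ereal t < T" for t
  proof -
    define x where "x = inverse_stereo (y t)"
    have x: "norm x = 1" "x \<noteq> north" "stereo x = y t"
      by (simp_all add: x_def inverse_stereo_neq_north stereo_inverse_stereo)
    have y': "(y has_vector_derivative G (y t)) (at t within {0..})"
      using assms t unfolding solution_def by auto
    obtain D where D: "(inverse_stereo has_derivative D) (at (stereo x))"
      "\<And>z. z \<in> tangent_space x \<Longrightarrow> D (stereo_jacobian x *v z) = z"
      using stereo_tangent_iso[OF x(1,2)] by metis
    have "(inverse_stereo has_derivative D) (at (y t) within y ` {0..})"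
      using D(1) x(3) has_derivative_at_withinI by auto
    from vector_derivative_diff_chain_within[OF y' this]
    have "((inverse_stereo \<circ> y) has_vector_derivative D (stereo_jacobian x *v F x)) (at t within {0..})"
      by (simp add: stereo_jacobian_F x)
    moreover have "F x \<in> tangent_space x"
      using P_tangent[OF x(1)] by (simp add: sphere_closed_loop_def)
    ultimately show ?thesis
      unfolding x_def[symmetric] by (simp only: D(2))
  qed
  then show ?thesis
    using assms by (simp add: solution_def)
qed

text \<open>Up to the first time at which it reaches \<open>north\<close>, a solution starting in \<open>M\<close> projects to
  a Euclidean solution and hence stays in the closed set \<open>M\<close>, which does not contain \<open>north\<close>.\<close>

lemma solution_avoids_north:
  assumes "solution F (sphere 0 1) T x" "x 0 \<in> M" "0 \<le> t" "ereal t < T"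
  shows "x t \<noteq> north"
proof
  assume north: "x t = north"
  have before: "ereal s < T" if "s \<le> t" for s
    using that assms(4) by (meson ereal_less_eq(3) order_le_less_trans)
  have cont: "continuous_on {0..t} x"
  proof (rule continuous_on_subset[of "{0..} \<inter> {..t}"])
    have "continuous (at s within {0..}) x" if "0 \<le> s" "s \<le> t" for s
    proof (rule has_vector_derivative_continuous)
      show "(x has_vector_derivative F (x s)) (at s within {0..})"
        using assms(1) that before[of s] by (simp add: solution_def)
    qed
    then show "continuous_on ({0..} \<inter> {..t}) x"
      by (auto simp: continuous_on_eq_continuous_within intro: continuous_within_subset)
  qed auto
  define Z where "Z = {s \<in> {0..t}. x s = north}"
  have "closed Z"
    unfolding Z_def by (rule continuous_closed_preimage_constant[OF cont]) simp
  moreover have "bounded Z"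
    by (rule bounded_subset[of "{0..t}"]) (auto simp: Z_def)
  ultimately have "compact Z"
    by (simp add: compact_eq_bounded_closed)
  moreover have "t \<in> Z"
    using assms(3) north by (simp add: Z_def)
  ultimately obtain s where "s \<in> Z" and s_min: "\<And>r. r \<in> Z \<Longrightarrow> s \<le> r"
    using compact_attains_inf[of Z] by blast
  then have s: "0 \<le> s" "s \<le> t" "x s = north"
    by (auto simp: Z_def)
  have "s \<noteq> 0"
    using s(3) assms(2) M_D(2) by metis
  then have "0 < s"
    using s(1) by simp
  \<comment> \<open>The time interval is half-open, so the first hitting time \<open>s\<close> is
    excluded and the restricted solution avoids \<open>north\<close> entirely.\<close>
  have sol: "solution F (sphere 0 1) (ereal s) x"
    using assms(1) \<open>0 < s\<close> before s(2) unfolding solution_def by auto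
  have off: "x r \<noteq> north" if "0 \<le> r" "r < s" for r
    using s_min[of r] that s(2) by (auto simp: Z_def)
  then have "solution G UNIV (ereal s) (stereo \<circ> x)"
    using solution_stereo[OF sol] by simp
  then have proj: "stereo (x r) \<in> stereo ` M" if "0 \<le> r" "r < s" for r
    using invariant assms(2) that unfolding forward_invariant_def by fastforce
  have "x r \<in> M" if r: "r \<in> {0..<s}" for r
  proof (rule in_M_if_stereo_in)
    show "norm (x r) = 1"
      using sol r by (simp add: solution_def)
  qed (use off proj r in simp_all)
  \<comment> \<open>Closedness of \<open>M\<close> carries membership to the limit time
    \<open>s\<close>.\<close>
  moreover have "continuous_on (closure {0..<s}) x"
    using cont s(2) \<open>0 < s\<close> by (auto intro: continuous_on_subset)
  ultimately have "x ` closure {0..<s} \<subseteq> M"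
    using closed_M by (intro image_closure_subset) auto
  then have "x s \<in> M"
    using \<open>0 < s\<close> by auto
  then show False
    using s(3) M_D(2) by blast
qed

lemma solution_in_M:
  assumes "solution F (sphere 0 1) T x" "x 0 \<in> M" "0 \<le> t" "ereal t < T"
  shows "x t \<in> M"
proof -
  have "solution G UNIV T (stereo \<circ> x)"
    using solution_stereo[OF assms(1)] solution_avoids_north[OF assms(1,2)] by blast
  then have "stereo (x t) \<in> stereo ` M"
    using invariant assms(2-) unfolding forward_invariant_def by fastforce
  moreover have "norm (x t) = 1"
    using assms by (simp add: solution_def)
  ultimately show ?thesis
    using in_M_if_stereo_in solution_avoids_north[OF assms] by blast
qed

text \<open>Both height gaps lie in [c, 2], so their product in the distance identity lies in
  [c^2, 4]. The constant 4 is 2 from this bound times 2 from comparing geodesic and chordal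
  distance.\<close>

lemma stereo_bilipschitz:
  assumes "x \<in> M" "y \<in> M"
  shows "geodesic_dist x y \<le> 4 * dist (stereo x) (stereo y)"
    and "dist (stereo x) (stereo y) \<le> geodesic_dist x y / c"
proof -
  note x = M_D[OF assms(1)] and y = M_D[OF assms(2)]
  define e where "e = dist (stereo x) (stereo y)"
  define s t where "s = 1 - north \<bullet> x" and "t = 1 - north \<bullet> y"
  have eq: "e\<^sup>2 * (s * t) = (dist x y)\<^sup>2"
    unfolding e_def s_def t_def
    using x y north_inner_less_1[OF x] north_inner_less_1[OF y] by (intro dist_stereo) auto
  have rng: "c \<le> s" "s \<le> 2" "c \<le> t" "t \<le> 2"
    using M_away assms Cauchy_Schwarz_ineq2[of north x] Cauchy_Schwarz_ineq2[of north y] x(1) y(1)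
    by (auto simp: s_def t_def)
  have "s * t \<le> 2 * 2"
    using rng c_pos by (intro mult_mono) auto
  then have "(dist x y)\<^sup>2 \<le> (2 * e)\<^sup>2"
    using mult_left_mono[of "s * t" 4 "e\<^sup>2"] eq by (simp add: power_mult_distrib)
  then have "dist x y \<le> 2 * e"
    by (rule power2_le_imp_le) (simp add: e_def)
  then show "geodesic_dist x y \<le> 4 * dist (stereo x) (stereo y)"
    using geodesic_dist_le_dist[OF x(1) y(1)] by (simp add: e_def)
  have "c * c \<le> s * t"
    using rng c_pos by (intro mult_mono) auto
  then have "(e * c)\<^sup>2 \<le> (dist x y)\<^sup>2"
    using mult_left_mono[of "c * c" "s * t" "e\<^sup>2"] eq by (simp add: power2_eq_square mult_ac)
  then have "e * c \<le> dist x y"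
    by (rule power2_le_imp_le) simp
  then show "dist (stereo x) (stereo y) \<le> geodesic_dist x y / c"
    using dist_le_geodesic_dist[OF x(1) y(1)] c_pos by (simp add: e_def field_simps)
qed

text \<open>The sum dominates both Lipschitz constants, 4 and 1 / c.\<close>

sublocale bilipschitz_conjugacy F "sphere 0 1" M geodesic_dist xd G stereo inverse_stereo "4 + 1 / c"
proof
  fix T x t
  assume x: "solution F (sphere 0 1) T x" "x 0 \<in> M"
  show "solution G UNIV T (stereo \<circ> x)"
    using solution_stereo[OF x(1)] solution_avoids_north[OF x] by blast
  show "x t \<in> M" if "0 \<le> t" "ereal t < T"
    using solution_in_M[OF x that] .
next
  show "0 < 4 + 1 / c"
    using c_pos by (simp add: add_pos_pos)
next
  fix x
  assume x: "x \<in> M"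
  show "inverse_stereo (stereo x) = x"
    using inverse_stereo_stereo[OF M_D[OF x]] .
  show nonneg: "0 \<le> geodesic_dist x xd"
    using geodesic_dist_nonneg M_D(1) x xd_in by blast
  have "4 * dist (stereo x) (stereo xd) \<le> (4 + 1 / c) * dist (stereo x) (stereo xd)"
    using c_pos by (intro mult_right_mono) auto
  then show "geodesic_dist x xd \<le> (4 + 1 / c) * dist (stereo x) (stereo xd)"
    using stereo_bilipschitz(1)[OF x xd_in] by linarith
  have "1 / c * geodesic_dist x xd \<le> (4 + 1 / c) * geodesic_dist x xd"
    using nonneg by (intro mult_right_mono) auto
  then show "dist (stereo x) (stereo xd) \<le> (4 + 1 / c) * geodesic_dist x xd"
    using stereo_bilipschitz(2)[OF x xd_in] by simp
qed (simp_all add: solution_inverse_stereo stereo_inverse_stereo)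

lemma solves_sphere_problem_lifted:
  assumes "solves_euclid_problem k (stereo ` M) \<kappa> (stereo xd) R"
  shows "solves_sphere_problem k P M (lifted_law P \<kappa>) xd {x \<in> sphere 0 1 - {north}. stereo x \<in> R}"
proof -
  from assms have stab: "stable_equilibrium k G UNIV (stereo ` M) dist (stereo xd)"
    and R: "R = region_of_attraction G UNIV (stereo ` M) dist (stereo xd)"
    by (simp_all add: solves_euclid_problem_def)
  have "equilibrium G (stereo xd)"
    using stab by (cases k) simp_all
  then have "equilibrium F xd"
    by (simp add: equilibrium_def sphere_closed_loop_def lifted_law_def euclid_closed_loop_def)
  \<comment> \<open>Since \<open>R\<close> lies in the projection of \<open>M\<close> and the
    projection is injective off \<open>north\<close>, the preimage of \<open>R\<close> in the
    punctured sphere already lies in \<open>M\<close>.\<close>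
  moreover have "x \<in> M" if "x \<in> sphere 0 1" "x \<noteq> north" "stereo x \<in> R" for x
    using in_M_if_stereo_in[of x] that by (simp add: R region_of_attraction_def)
  then have "{x \<in> sphere 0 1 - {north}. stereo x \<in> R} = {x \<in> M. stereo x \<in> R}"
    using M_D(2) M_sphere by blast
  ultimately show ?thesis
    using forward_invariant_transfer[OF invariant] stable_equilibrium_transfer[OF stab]
    by (simp add: solves_sphere_problem_def region_of_attraction_transfer R)
qed

text \<open>By compactness of \<open>M\<close>, the smallest singular value of \<open>Sigma_mat P x\<close> is bounded away
  from zero.\<close>

lemma Sigma_mat_uniformly_surj:
  obtains \<sigma> where "0 < \<sigma>"
    and "\<And>x w. x \<in> M \<Longrightarrow> \<sigma> * norm w \<le> norm (transpose (Sigma_mat P x) *v w)"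
proof -
  define \<phi> where "\<phi> z = norm (transpose (Sigma_mat P (fst z)) *v snd z)" for z
  define K where "K = M \<times> sphere (0 :: real ^ 'n) 1"
  have "compact M"
    using closed_M bounded_subset[OF bounded_sphere M_sphere] by (simp add: compact_eq_bounded_closed)
  then have "compact K"
    by (simp add: K_def compact_Times)
  moreover have "K \<noteq> {}"
    using xd_in by (auto simp: K_def)
  moreover have "continuous_on K \<phi>"
  proof -
    have "continuous_on M (Sigma_mat P)"
      unfolding Sigma_mat_def[abs_def]
      by (intro continuous_on_matrix_mult continuous_on_stereo_jacobian
          continuous_on_subset[OF continuous_P]) (use M_away c_pos in force)+
    then have "continuous_on K (\<lambda>z. Sigma_mat P (fst z))"
      by (rule continuous_on_compose2) (auto simp: K_def intro: continuous_intros)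
    then show ?thesis
      unfolding \<phi>_def[abs_def] transpose_matrix_vector vector_matrix_mult_def
      by (intro continuous_on_norm continuous_on_vec_lambda continuous_on_sum continuous_on_mult
          continuous_on_component continuous_on_snd continuous_on_id)
  qed
  ultimately have "\<exists>z\<in>K. \<forall>z'\<in>K. \<phi> z \<le> \<phi> z'"
    by (rule continuous_attains_inf)
  then obtain z where z: "z \<in> K" and z_min: "\<And>z'. z' \<in> K \<Longrightarrow> \<phi> z \<le> \<phi> z'"
    by blast
  have "surj ((*v) (Sigma_mat P (fst z)))"
    using z M_D by (intro surj_Sigma_mat) (auto simp: K_def)
  then obtain u where u: "Sigma_mat P (fst z) *v u = snd z"
    by (metis surjD)
  \<comment> \<open>For z = (x, w), surjectivity gives w = Sigma u, so Sigma^T w = 0 would force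
    |w|^2 = u . (Sigma^T w) = 0, although w is a unit vector.\<close>
  have "\<phi> z \<noteq> 0"
  proof
    assume "\<phi> z = 0"
    then have "snd z \<bullet> snd z = 0"
      by (metis \<phi>_def dot_lmul_matrix inner_zero_left norm_eq_zero transpose_matrix_vector u)
    then show False
      using z by (auto simp: K_def)
  qed
  then have "0 < \<phi> z"
    by (simp add: \<phi>_def)
  moreover have "\<phi> z * norm w \<le> norm (transpose (Sigma_mat P x) *v w)" if "x \<in> M" for x w
  proof (cases "w = 0")
    case False
    \<comment> \<open>By homogeneity, the minimum over unit vectors bounds all nonzero
      \<open>w\<close>.\<close>
    define v where "v = (1 / norm w) *\<^sub>R w"
    have "\<phi> z \<le> norm (transpose (Sigma_mat P x) *v v)"
      using z_min[of "(x, v)"] that False by (simp add: \<phi>_def K_def v_def)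
    also have "\<dots> = norm (transpose (Sigma_mat P x) *v w) / norm w"
      unfolding v_def matrix_vector_mult_scaleR by simp
    finally show ?thesis
      using False by (simp add: field_simps)
  qed simp
  ultimately show ?thesis
    by (rule that)
qed

lemma bounded_lifted_law:
  assumes "bounded ((\<lambda>\<xi>. \<kappa> \<xi> (stereo xd)) ` stereo ` M)"
  shows "bounded ((\<lambda>x. lifted_law P \<kappa> x xd) ` M)"
proof -
  obtain B where B: "\<And>x. x \<in> M \<Longrightarrow> norm (\<kappa> (stereo x) (stereo xd)) \<le> B"
    using assms unfolding bounded_iff by blast
  obtain \<sigma> where \<sigma>: "0 < \<sigma>"
    "\<And>x w. x \<in> M \<Longrightarrow> \<sigma> * norm w \<le> norm (transpose (Sigma_mat P x) *v w)"
    using Sigma_mat_uniformly_surj by blast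
  have "norm (lifted_law P \<kappa> x xd) \<le> B / \<sigma>" if "x \<in> M" for x
  proof -
    have "norm (lifted_law P \<kappa> x xd) \<le> norm (\<kappa> (stereo x) (stereo xd)) / \<sigma>"
      unfolding lifted_law_def
      using surj_Sigma_mat[OF M_D[OF that]] \<sigma> that by (intro norm_right_pinv_le) auto
    also have "\<dots> \<le> B / \<sigma>"
      using B[OF that] \<sigma>(1) by (simp add: divide_right_mono)
    finally show ?thesis .
  qed
  then show ?thesis
    unfolding bounded_iff by blast
qed

end

section \<open>The conic free space\<close>

lemma closed_free_space: "closed (free_space N a \<theta>)"
proof -
  have "free_space N a \<theta> = sphere 0 1 \<inter> (\<Inter>i\<in>{0..N}. {x. x \<bullet> a i \<le> cos (\<theta> i)})"
    unfolding free_space_def constraint_zone_def by (auto simp flip: not_less)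
  then show ?thesis
    by (auto intro!: closed_Int closed_INT closed_Collect_le continuous_intros)
qed

theorem theorem1:
  fixes P :: "real ^ ('n::finite option) \<Rightarrow> real ^ 'm::finite ^ ('n option)"
    and N :: nat
    and a :: "nat \<Rightarrow> real ^ ('n option)"
    and \<theta> :: "nat \<Rightarrow> real"
    and x\<^sub>d :: "real ^ ('n option)"
    and \<kappa> :: "real ^ 'n \<Rightarrow> real ^ 'n \<Rightarrow> real ^ 'n"
    and k :: stability_kind
    and R :: "(real ^ 'n) set"
  assumes "smooth P"
    and "\<And>x. x \<in> sphere 0 1 \<Longrightarrow> range (\<lambda>u. P x *v u) \<subseteq> tangent_space x"
    and "\<And>i. i \<in> {0..N} \<Longrightarrow> a i \<in> sphere 0 1"
    and "\<And>i. i \<in> {0..N} \<Longrightarrow> \<theta> i \<in> {0<..<pi / 2}"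
    and A1: "\<And>x. x \<in> sphere 0 1 - {north} \<Longrightarrow> rank (P x) = CARD('n)"
    and A2: "\<And>i j. i \<in> {0..N} \<Longrightarrow> j \<in> {0..N} \<Longrightarrow> i \<noteq> j \<Longrightarrow> a i \<bullet> a j < cos (\<theta> i + \<theta> j)"
    and A3: "a 0 = north"
    and A4: "x\<^sub>d \<in> (top_of_set (sphere 0 1)) interior_of (free_space N a \<theta>)"
    and "solves_euclid_problem k (stereo ` free_space N a \<theta>) \<kappa> (stereo x\<^sub>d) R"
  shows "solves_sphere_problem k P (free_space N a \<theta>) (lifted_law P \<kappa>) x\<^sub>d
           {x \<in> sphere 0 1 - {north}. stereo x \<in> R}
       \<and> (bounded ((\<lambda>\<xi>. \<kappa> \<xi> (stereo x\<^sub>d)) ` stereo ` free_space N a \<theta>)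
           \<longrightarrow> bounded ((\<lambda>x. lifted_law P \<kappa> x x\<^sub>d) ` free_space N a \<theta>))"
proof -
  \<comment> \<open>The gap comes from zone 0, centred at \<open>north\<close> by \<open>A3\<close>:
    outside it \<open>north \<bullet> x\<close> is at most \<open>cos (\<theta> 0)\<close>, which is
    below 1 because \<theta> 0 lies in (0, pi/2).\<close>
  interpret lifted_system P "free_space N a \<theta>" "1 - cos (\<theta> 0)" \<kappa> x\<^sub>d
  proof
    show "continuous_on UNIV P"
      using \<open>smooth P\<close> times_cont_differentiable.simps(1) unfolding smooth_def by blast
    show "P x *v u \<in> tangent_space x" if "norm x = 1" for x u
      using assms(2)[of x] that by auto
    show "rank (P x) = CARD('n)" if "norm x = 1" "x \<noteq> north" for x
      using A1[of x] that by simp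
    show "closed (free_space N a \<theta>)"
      by (rule closed_free_space)
    show "free_space N a \<theta> \<subseteq> sphere 0 1"
      by (auto simp: free_space_def)
    show "0 < 1 - cos (\<theta> 0)"
      using assms(4)[of 0] cos_monotone_0_pi[of 0 "\<theta> 0"] by simp
    show "1 - cos (\<theta> 0) \<le> 1 - north \<bullet> x" if "x \<in> free_space N a \<theta>" for x
      using that A3 unfolding free_space_def constraint_zone_def
      by (auto simp: not_less inner_commute dest!: bspec[of _ _ 0])
    show "x\<^sub>d \<in> free_space N a \<theta>"
      using A4 by (rule subsetD[OF interior_of_subset])
    show "forward_invariant (euclid_closed_loop \<kappa> (stereo x\<^sub>d)) UNIV (stereo ` free_space N a \<theta>)"
      using assms(9) by (simp add: solves_euclid_problem_def)
  qed
  show ?thesis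
    using solves_sphere_problem_lifted[OF assms(9)] bounded_lifted_law by blast
qed

end
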